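(* Minimizing the efficiency bound $$V=E\{\alpha_w^2(A,X)\,\sigma^2(A,X)\}$$ over $\alpha_w\in\mathcal{H}$ subject to the constraints $E\{\alpha_w(A,X)A\}=1$ and $E\{\alpha_w(A,X)\mid X\}=0$ has the solution $$\alpha_w(a,x)=\frac{d(a,x)}{E\{d(A,X)A\}},$$ which implies the optimally efficient estimand $$\langle\mu,\alpha_w\rangle=\frac{E\{d(A,X)Y\}}{E\{d(A,X)A\}}.$$
   Context: $(Y,A,X)$ is a random variable with distribution $P_0$, where $Y\in\mathbb{R}$ is an outcome, $A\in\mathbb{R}$ is a treatment and $X\in\mathbb{R}^p$ is a covariate vector. $\mathcal{H}$ is the Hilbert space of functions $f:\mathbb{R}\times\mathbb{R}^p\to\mathbb{R}$ with inner product $\langle f,g\rangle=E\{f(A,X)g(A,X)\}$ and finite norm $\|f\|=\langle f,f\rangle^{1/2}<\infty$. Write $\mu(A,X)=E(Y|A,X)$, assumed to lie in $\mathcal{H}$, and $\sigma^2(A,X)=\mathrm{var}(Y|A,X)$ (positive, as it appears in denominators). Define $$\tilde\pi(x)=\frac{E\{A/\sigma^2(A,X)\mid X=x\}}{E\{1/\sigma^2(A,X)\mid X=x\}},\qquad d(a,x)=\frac{a-\tilde\pi(x)}{\sigma^2(a,x)}.$$ Origin of $V$: for a weight function $w$, the weighted average derivative effect is $\theta_w=E\{w(A,X)\mu'(A,X)\}$ (prime is the derivative in the first argument), its Riesz representer $\alpha_w\in\mathcal{H}$ satisfies $E\{w(A,X)f'(A,X)\}=\langle f,\alpha_w\rangle$,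 and, for an i.i.d. sample $(y_i,a_i,x_i)_{i=1}^n$, an efficient estimator $\hat\theta_w$ (with $w$ known) satisfies $\sqrt{n}(\hat\theta_w-\theta_{w,S})\to\mathcal{N}(0,V)$ in distribution with $V=E\{\alpha_w^2(A,X)\sigma^2(A,X)\}$, where $\theta_{w,S}=n^{-1}\sum_{i=1}^n w(a_i,x_i)\mu'(a_i,x_i)$. The estimand associated with a representer $\alpha_w$ is $\langle\mu,\alpha_w\rangle=E\{\alpha_w(A,X)Y\}$.
   Formalization: It is assumed that d lies in H (otherwise the claimed solution is not in H and the claim fails), that E{d(A,X)A} exists and is nonzero, and that A/σ²(A,X) and 1/σ²(A,X) are integrable so that their conditional expectations are defined. *)

theory Defs
  imports "HOL-Probability.Probability"
begin

definition sigma_gen :: "'w measure \<Rightarrow> ('w \<Rightarrow> 'b::topological_space) \<Rightarrow> 'w measure" where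
  "sigma_gen M T = vimage_algebra (space M) T borel"

text \<open>\<open>g\<close> is a version of \<open>t \<mapsto> E(Z | T = t)\<close>: it is determined only up to null sets
  of the distribution of \<open>T\<close>.\<close>

definition is_cond_mean ::
  "'w measure \<Rightarrow> ('w \<Rightarrow> 'b::topological_space) \<Rightarrow> ('w \<Rightarrow> real) \<Rightarrow> ('b \<Rightarrow> real) \<Rightarrow> bool" where
  "is_cond_mean M T Z g \<longleftrightarrow>
     integrable M Z \<and> g \<in> borel_measurable borel \<and>
     (AE \<omega> in M. g (T \<omega>) = real_cond_exp M (sigma_gen M T) Z \<omega>)"

text \<open>\<open>v\<close> is a version of \<open>t \<mapsto> var(Z | T = t)\<close>. The nonnegative conditional expectation is used
  so that only almost sure finiteness of the conditional variance is required, not a finite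
  second moment of \<open>Z\<close>. The conjunct \<open>0 \<le> v (T \<omega>)\<close> is needed because \<open>ennreal\<close> truncates
  negative reals to \<open>0\<close>.\<close>

definition is_cond_var ::
  "'w measure \<Rightarrow> ('w \<Rightarrow> 'b::topological_space) \<Rightarrow> ('w \<Rightarrow> real) \<Rightarrow> ('b \<Rightarrow> real) \<Rightarrow> bool" where
  "is_cond_var M T Z v \<longleftrightarrow>
     integrable M Z \<and> v \<in> borel_measurable borel \<and>
     (AE \<omega> in M. 0 \<le> v (T \<omega>) \<and>
        ennreal (v (T \<omega>)) =
          nn_cond_exp M (sigma_gen M T)
            (\<lambda>\<omega>'. ennreal ((Z \<omega>' - real_cond_exp M (sigma_gen M T) Z \<omega>')\<^sup>2)) \<omega>)"

text \<open>The Hilbert space of square-integrable functions of \<open>T\<close>, represented by functions rather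
  than by classes of almost surely equal functions.\<close>

definition L2_fun :: "'w measure \<Rightarrow> ('w \<Rightarrow> 'b::topological_space) \<Rightarrow> ('b \<Rightarrow> real) set" where
  "L2_fun M T = {f \<in> borel_measurable borel. integrable M (\<lambda>\<omega>. (f (T \<omega>))\<^sup>2)}"

definition L2_inner ::
  "'w measure \<Rightarrow> ('w \<Rightarrow> 'b) \<Rightarrow> ('b \<Rightarrow> real) \<Rightarrow> ('b \<Rightarrow> real) \<Rightarrow> real" where
  "L2_inner M T f g = (\<integral>\<omega>. f (T \<omega>) * g (T \<omega>) \<partial>M)"

text \<open>\<open>E(\<alpha>\<^sup>2(A,X) \<sigma>\<^sup>2(A,X))\<close> for \<open>T = (A,X)\<close>, which may be infinite for a square-integrable \<open>\<alpha>\<close>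
  when the conditional variance is unbounded.\<close>

definition efficiency_bound ::
  "'w measure \<Rightarrow> ('w \<Rightarrow> 'b) \<Rightarrow> ('b \<Rightarrow> real) \<Rightarrow> ('b \<Rightarrow> real) \<Rightarrow> ennreal" where
  "efficiency_bound M T v \<alpha> = (\<integral>\<^sup>+\<omega>. ennreal ((\<alpha> (T \<omega>))\<^sup>2 * v (T \<omega>)) \<partial>M)"

text \<open>The Bochner integral of a non-integrable function is \<open>0\<close>, so the first constraint includes
  the integrability of \<open>\<alpha>(A,X) A\<close>.\<close>

definition feasible ::
  "'w measure \<Rightarrow> ('w \<Rightarrow> real) \<Rightarrow> ('w \<Rightarrow> 'x::topological_space) \<Rightarrow> (real \<times> 'x \<Rightarrow> real) \<Rightarrow> bool" where
  "feasible M A X \<alpha> \<longleftrightarrow>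
     \<alpha> \<in> L2_fun M (\<lambda>\<omega>. (A \<omega>, X \<omega>)) \<and>
     (\<integral>\<omega>. \<alpha> (A \<omega>, X \<omega>) * A \<omega> \<partial>M) = 1 \<and>
     (AE \<omega> in M. real_cond_exp M (sigma_gen M X) (\<lambda>\<omega>'. \<alpha> (A \<omega>', X \<omega>')) \<omega> = 0)"

end

theory Submission
  imports Defs
begin

text \<open>
  Write \<open>D = d(A,X)\<close>, \<open>S = \<sigma>\<^sup>2(A,X)\<close> and \<open>c = E(D A)\<close>. The proof is a Hilbert space projection
  for the weighted inner product \<open>(f, g) \<mapsto> E(f g S)\<close>. Since \<open>D S = A - \<pi>(X)\<close>, pairing a feasible
  \<open>\<alpha>\<close> of finite bound with \<open>D\<close> gives \<open>E(\<alpha> D S) = E(\<alpha> A) - E(\<alpha> \<pi>(X)) = 1\<close>: the first constraint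
  evaluates the first term, and the second constraint kills the second one, as \<open>\<pi>(X)\<close> is a
  function of \<open>X\<close>. The weighting in \<open>\<pi>\<close> is exactly what makes \<open>E(D | X) = 0\<close>
  (\<open>real_cond_exp_weighted_centering\<close>), so that \<open>D / c\<close> is itself feasible and, by the same
  computation, \<open>E(D\<^sup>2 S) = c\<close>. Expanding the square gives
  \<open>E(\<alpha>\<^sup>2 S) = 1/c + E((\<alpha> - D/c)\<^sup>2 S)\<close> (\<open>weighted_square_decomposition\<close>), which shows
  minimality of \<open>D / c\<close> and, as \<open>S > 0\<close>, uniqueness up to null sets.

  Integrability needs care. No moment of \<open>A\<close> or \<open>\<pi>(X)\<close> is available, so the identity
  \<open>E(D\<^sup>2 S) = c\<close> is obtained by truncating \<open>\<pi>(X)\<close> and using that \<open>D (A - \<pi>(X)) = D\<^sup>2 S\<close> is nonnegative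
  (\<open>integral_mult_diff_conditionally_centered\<close>). In particular the optimal bound is finite, and
  competitors with an infinite bound can be discarded; for the others, \<open>\<alpha> D S\<close> is integrable by
  Cauchy--Schwarz. Similarly \<open>Y\<close> need not have a second moment, but \<open>D (Y - \<mu>(A,X))\<close> has one, equal
  to \<open>E(D\<^sup>2 S)\<close>; hence \<open>D Y\<close> is integrable (\<open>integrable_mult_of_cond_var\<close>) and conditioning
  on \<open>(A,X)\<close> yields the estimand.
\<close>

section \<open>The sigma-algebra generated by a random variable\<close>

lemma measurable_sigma_gen_comp:
  assumes "g \<in> borel_measurable borel"
  shows "(\<lambda>\<omega>. g (T \<omega>)) \<in> borel_measurable (sigma_gen M T)"
proof -
  have "T \<in> measurable (sigma_gen M T) borel"
    unfolding sigma_gen_def by (rule measurable_vimage_algebra1) simp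
  then show ?thesis using assms by (rule measurable_compose)
qed

lemma subalgebra_sigma_gen:
  assumes "T \<in> borel_measurable M"
  shows "subalgebra M (sigma_gen M T)"
  unfolding subalgebra_def sigma_gen_def
  using assms by (auto simp: sets_vimage_algebra2 intro: measurable_sets)

lemma (in finite_measure) sigma_finite_subalgebra_sigma_gen:
  assumes "T \<in> borel_measurable M"
  shows "sigma_finite_subalgebra M (sigma_gen M T)"
proof -
  have "finite_measure_subalgebra M (sigma_gen M T)"
    using subalgebra_sigma_gen[OF assms]
    by (simp add: finite_measure_subalgebra_def finite_measure_subalgebra_axioms_def
        finite_measure_axioms)
  then show ?thesis by (rule finite_measure_subalgebra_is_sigma_finite)
qed

section \<open>Integrability of products\<close>

lemma integrable_mult_of_square_integrable:
  fixes f g :: "'a \<Rightarrow> real"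
  assumes [measurable]: "f \<in> borel_measurable M" "g \<in> borel_measurable M"
    and f: "integrable M (\<lambda>x. (f x)\<^sup>2)" and g: "integrable M (\<lambda>x. (g x)\<^sup>2)"
  shows "integrable M (\<lambda>x. f x * g x)"
proof (rule Bochner_Integration.integrable_bound)
  show "integrable M (\<lambda>x. (f x)\<^sup>2 + (g x)\<^sup>2)" using f g by simp
  show "AE x in M. norm (f x * g x) \<le> norm ((f x)\<^sup>2 + (g x)\<^sup>2)"
  proof (rule AE_I2)
    fix x
    have "2 * (\<bar>f x\<bar> * \<bar>g x\<bar>) \<le> (f x)\<^sup>2 + (g x)\<^sup>2"
      using sum_squares_bound[of "\<bar>f x\<bar>" "\<bar>g x\<bar>"] by simp
    moreover have "0 \<le> \<bar>f x\<bar> * \<bar>g x\<bar>" by simp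
    ultimately show "norm (f x * g x) \<le> norm ((f x)\<^sup>2 + (g x)\<^sup>2)"
      unfolding real_norm_def abs_mult by linarith
  qed
qed measurable

lemma integrable_mult_of_weighted_square_integrable:
  fixes f g S :: "'a \<Rightarrow> real"
  assumes [measurable]: "f \<in> borel_measurable M" "g \<in> borel_measurable M" "S \<in> borel_measurable M"
    and S: "AE x in M. 0 \<le> S x"
    and f: "integrable M (\<lambda>x. (f x)\<^sup>2 * S x)" and g: "integrable M (\<lambda>x. (g x)\<^sup>2 * S x)"
  shows "integrable M (\<lambda>x. f x * g x * S x)"
proof -
  have sq: "integrable M (\<lambda>x. (h x * sqrt (S x))\<^sup>2)"
    if "integrable M (\<lambda>x. (h x)\<^sup>2 * S x)" and [measurable]: "h \<in> borel_measurable M"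
    for h :: "'a \<Rightarrow> real"
    by (rule integrable_cong_AE_imp[OF that(1)]) (use S in \<open>auto simp: power_mult_distrib\<close>)
  have "integrable M (\<lambda>x. (f x * sqrt (S x)) * (g x * sqrt (S x)))"
    by (intro integrable_mult_of_square_integrable sq f g) measurable
  then show ?thesis
    by (rule integrable_cong_AE_imp) (use S in \<open>auto simp: algebra_simps\<close>)
qed

section \<open>Conditionally centered random variables\<close>

context sigma_finite_subalgebra
begin

lemma integral_mult_conditionally_centered:
  assumes [measurable]: "h \<in> borel_measurable F" "Z \<in> borel_measurable M"
    and int: "integrable M (\<lambda>\<omega>. h \<omega> * Z \<omega>)"
    and centered: "AE \<omega> in M. real_cond_exp M F Z \<omega> = 0"
  shows "(\<integral>\<omega>. h \<omega> * Z \<omega> \<partial>M) = 0"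
proof -
  have "(\<integral>\<omega>. h \<omega> * Z \<omega> \<partial>M) = (\<integral>\<omega>. h \<omega> * real_cond_exp M F Z \<omega> \<partial>M)"
    using real_cond_exp_intg(2)[OF int] by simp
  also have "\<dots> = 0"
    by (rule integral_eq_zero_AE) (use centered in auto)
  finally show ?thesis .
qed

text \<open>
  Formally \<open>E(Z (A - h)) = E(Z A)\<close> because \<open>h\<close> is a function of the conditioning information and \<open>Z\<close>
  is conditionally centered, but \<open>Z h\<close> is not assumed integrable. On the events \<open>|h| \<le> n\<close> it is,
  and the sign condition lets monotone convergence remove the truncation.
\<close>

lemma integral_mult_diff_conditionally_centered:
  fixes h Z A :: "'a \<Rightarrow> real"
  assumes h[measurable]: "h \<in> borel_measurable F"
    and [measurable]: "A \<in> borel_measurable M"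
    and Z: "integrable M Z" and centered: "AE \<omega> in M. real_cond_exp M F Z \<omega> = 0"
    and ZA: "integrable M (\<lambda>\<omega>. Z \<omega> * A \<omega>)"
    and nonneg: "AE \<omega> in M. 0 \<le> Z \<omega> * (A \<omega> - h \<omega>)"
  shows "integrable M (\<lambda>\<omega>. Z \<omega> * (A \<omega> - h \<omega>))"
    and "(\<integral>\<omega>. Z \<omega> * (A \<omega> - h \<omega>) \<partial>M) = (\<integral>\<omega>. Z \<omega> * A \<omega> \<partial>M)"
proof -
  have hM[measurable]: "h \<in> borel_measurable M" by (rule measurable_from_subalg[OF subalg h])
  have ZM[measurable]: "Z \<in> borel_measurable M" using Z by simp
  define ind :: "nat \<Rightarrow> 'a \<Rightarrow> real" where "ind n \<omega> = (if \<bar>h \<omega>\<bar> \<le> real n then 1 else 0)" for n \<omega>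
  have indF[measurable]: "ind n \<in> borel_measurable F" for n unfolding ind_def by measurable
  have indM[measurable]: "ind n \<in> borel_measurable M" for n
    by (rule measurable_from_subalg[OF subalg indF])
  have ind_lim: "(\<lambda>n. ind n \<omega>) \<longlonglongrightarrow> 1" for \<omega>
  proof (rule tendsto_eventually)
    obtain N where "\<bar>h \<omega>\<bar> \<le> real N" using real_arch_simple by blast
    then show "\<forall>\<^sub>F n in sequentially. ind n \<omega> = 1"
      unfolding ind_def by (intro eventually_sequentiallyI[of N]) auto
  qed
  have int1: "integrable M (\<lambda>\<omega>. ind n \<omega> * (Z \<omega> * A \<omega>))" for n
    by (rule Bochner_Integration.integrable_bound[OF ZA]) (auto simp: ind_def)
  have int2: "integrable M (\<lambda>\<omega>. (ind n \<omega> * h \<omega>) * Z \<omega>)" for n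
  proof (rule Bochner_Integration.integrable_bound)
    show "integrable M (\<lambda>\<omega>. real n * Z \<omega>)" using Z by simp
    show "AE \<omega> in M. norm ((ind n \<omega> * h \<omega>) * Z \<omega>) \<le> norm (real n * Z \<omega>)"
      by (auto simp: ind_def abs_mult intro!: mult_right_mono)
  qed measurable
  have eq: "ind n \<omega> * (Z \<omega> * (A \<omega> - h \<omega>)) = ind n \<omega> * (Z \<omega> * A \<omega>) - (ind n \<omega> * h \<omega>) * Z \<omega>" for n \<omega>
    by (simp add: algebra_simps)
  have trunc_int: "integrable M (\<lambda>\<omega>. ind n \<omega> * (Z \<omega> * (A \<omega> - h \<omega>)))" for n
    unfolding eq using int1 int2 by simp
  have "(\<integral>\<omega>. (ind n \<omega> * h \<omega>) * Z \<omega> \<partial>M) = 0" for n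
    by (rule integral_mult_conditionally_centered[OF _ _ int2 centered]) measurable
  then have trunc: "(\<integral>\<omega>. ind n \<omega> * (Z \<omega> * (A \<omega> - h \<omega>)) \<partial>M) = (\<integral>\<omega>. ind n \<omega> * (Z \<omega> * A \<omega>) \<partial>M)" for n
    unfolding eq using int1 int2 by simp
  have lim: "(\<lambda>n. \<integral>\<omega>. ind n \<omega> * (Z \<omega> * A \<omega>) \<partial>M) \<longlonglongrightarrow> (\<integral>\<omega>. Z \<omega> * A \<omega> \<partial>M)"
  proof (rule integral_dominated_convergence[where w="\<lambda>\<omega>. norm (Z \<omega> * A \<omega>)"])
    show "AE \<omega> in M. (\<lambda>n. ind n \<omega> * (Z \<omega> * A \<omega>)) \<longlonglongrightarrow> Z \<omega> * A \<omega>"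
      using tendsto_mult_right[OF ind_lim] by auto
    show "AE \<omega> in M. norm (ind n \<omega> * (Z \<omega> * A \<omega>)) \<le> norm (Z \<omega> * A \<omega>)" for n
      by (auto simp: ind_def)
  qed (use ZA in auto)
  have mono: "AE \<omega> in M. mono (\<lambda>n. ind n \<omega> * (Z \<omega> * (A \<omega> - h \<omega>)))"
    using nonneg
  proof eventually_elim
    case (elim \<omega>)
    then show ?case by (intro monoI mult_right_mono) (auto simp: ind_def)
  qed
  have conv: "AE \<omega> in M. (\<lambda>n. ind n \<omega> * (Z \<omega> * (A \<omega> - h \<omega>))) \<longlonglongrightarrow> Z \<omega> * (A \<omega> - h \<omega>)"
    using tendsto_mult_right[OF ind_lim] by auto
  note * = trunc_int mono conv lim[folded trunc]
  show "integrable M (\<lambda>\<omega>. Z \<omega> * (A \<omega> - h \<omega>))"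
    by (rule integrable_monotone_convergence[OF *]) measurable
  show "(\<integral>\<omega>. Z \<omega> * (A \<omega> - h \<omega>) \<partial>M) = (\<integral>\<omega>. Z \<omega> * A \<omega> \<partial>M)"
    by (rule integral_monotone_convergence[OF *]) measurable
qed

text \<open>
  Centering \<open>A\<close> at its conditional mean under the weight \<open>W\<close>: the quotient \<open>m\<^sub>1 / m\<^sub>0\<close> is chosen such
  that \<open>E(A W | F) = (m\<^sub>1 / m\<^sub>0) E(W | F)\<close>, which is legitimate because a positive weight has a
  positive conditional mean.
\<close>

lemma real_cond_exp_weighted_centering:
  fixes A W m0 m1 :: "'a \<Rightarrow> real"
  assumes m0[measurable]: "m0 \<in> borel_measurable F" and m1[measurable]: "m1 \<in> borel_measurable F"
    and W: "integrable M W" and W_pos: "AE \<omega> in M. 0 < W \<omega>"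
    and AW: "integrable M (\<lambda>\<omega>. A \<omega> * W \<omega>)"
    and m0_eq: "AE \<omega> in M. m0 \<omega> = real_cond_exp M F W \<omega>"
    and m1_eq: "AE \<omega> in M. m1 \<omega> = real_cond_exp M F (\<lambda>\<omega>. A \<omega> * W \<omega>) \<omega>"
    and int: "integrable M (\<lambda>\<omega>. (A \<omega> - m1 \<omega> / m0 \<omega>) * W \<omega>)"
  shows "AE \<omega> in M. real_cond_exp M F (\<lambda>\<omega>. (A \<omega> - m1 \<omega> / m0 \<omega>) * W \<omega>) \<omega> = 0"
proof -
  have WM[measurable]: "W \<in> borel_measurable M" using W by simp
  have eq: "(A \<omega> - m1 \<omega> / m0 \<omega>) * W \<omega> = A \<omega> * W \<omega> - (m1 \<omega> / m0 \<omega>) * W \<omega>" for \<omega>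
    by (rule left_diff_distrib)
  have pW: "integrable M (\<lambda>\<omega>. (m1 \<omega> / m0 \<omega>) * W \<omega>)"
    using Bochner_Integration.integrable_diff[OF AW int] by (simp add: left_diff_distrib)
  have "AE \<omega> in M. real_cond_exp M F (\<lambda>\<omega>. (m1 \<omega> / m0 \<omega>) * W \<omega>) \<omega>
      = (m1 \<omega> / m0 \<omega>) * real_cond_exp M F W \<omega>"
    by (rule real_cond_exp_mult[OF _ WM pW]) measurable
  moreover have "AE \<omega> in M. 0 < real_cond_exp M F W \<omega>"
    by (rule real_cond_exp_gr_c[OF W W_pos])
  moreover have "AE \<omega> in M. real_cond_exp M F (\<lambda>\<omega>. (A \<omega> - m1 \<omega> / m0 \<omega>) * W \<omega>) \<omega>
      = real_cond_exp M F (\<lambda>\<omega>. A \<omega> * W \<omega>) \<omega> - real_cond_exp M F (\<lambda>\<omega>. (m1 \<omega> / m0 \<omega>) * W \<omega>) \<omega>"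
    unfolding eq by (rule real_cond_exp_diff[OF AW pW])
  ultimately show ?thesis using m0_eq m1_eq by eventually_elim auto
qed

text \<open>
  The tower property for nonnegative functions gives \<open>E(D\<^sup>2 (Y - E(Y | F))\<^sup>2) = E(D\<^sup>2 S)\<close>, so the
  residual part of \<open>D Y\<close> is square-integrable even when \<open>Y\<close> is not.
\<close>

lemma integrable_mult_of_cond_var:
  fixes D Y S :: "'a \<Rightarrow> real"
  assumes fin: "finite_measure M"
    and D[measurable]: "D \<in> borel_measurable F" and Y[measurable]: "Y \<in> borel_measurable M"
    and S: "AE \<omega> in M. ennreal (S \<omega>)
      = nn_cond_exp M F (\<lambda>\<omega>. ennreal ((Y \<omega> - real_cond_exp M F Y \<omega>)\<^sup>2)) \<omega>"
    and D2S: "integrable M (\<lambda>\<omega>. (D \<omega>)\<^sup>2 * S \<omega>)"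
    and Dm: "integrable M (\<lambda>\<omega>. D \<omega> * real_cond_exp M F Y \<omega>)"
  shows "integrable M (\<lambda>\<omega>. D \<omega> * Y \<omega>)"
proof -
  have [measurable]: "D \<in> borel_measurable M" by (rule measurable_from_subalg[OF subalg D])
  define R where "R \<omega> = Y \<omega> - real_cond_exp M F Y \<omega>" for \<omega>
  have R[measurable]: "R \<in> borel_measurable M" unfolding R_def by measurable
  have D2S_fin: "(\<integral>\<^sup>+\<omega>. ennreal ((D \<omega>)\<^sup>2 * S \<omega>) \<partial>M) < \<infinity>"
    using integrableD(2)[OF D2S] by (simp add: less_top)
  have "(\<integral>\<^sup>+\<omega>. ennreal ((D \<omega> * R \<omega>)\<^sup>2) \<partial>M)
      = (\<integral>\<^sup>+\<omega>. ennreal ((D \<omega>)\<^sup>2) * ennreal ((R \<omega>)\<^sup>2) \<partial>M)"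
    by (simp add: power_mult_distrib ennreal_mult)
  also have "\<dots> = (\<integral>\<^sup>+\<omega>. ennreal ((D \<omega>)\<^sup>2) * nn_cond_exp M F (\<lambda>\<omega>. ennreal ((R \<omega>)\<^sup>2)) \<omega> \<partial>M)"
    by (rule nn_cond_exp_intg[symmetric]) measurable
  also have "\<dots> = (\<integral>\<^sup>+\<omega>. ennreal ((D \<omega>)\<^sup>2 * S \<omega>) \<partial>M)"
    by (rule nn_integral_cong_AE) (use S in \<open>auto simp: R_def ennreal_mult'\<close>)
  finally have DR2: "integrable M (\<lambda>\<omega>. (D \<omega> * R \<omega>)\<^sup>2)"
    using D2S_fin by (intro integrableI_bounded) auto
  have "integrable M (\<lambda>\<omega>. D \<omega> * R \<omega>)"
    by (rule finite_measure.square_integrable_imp_integrable[OF fin _ DR2]) measurable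
  from Bochner_Integration.integrable_add[OF this Dm] show ?thesis
    by (simp add: R_def algebra_simps)
qed

end

section \<open>Optimality\<close>

text \<open>
  The Pythagorean identity in the weighted inner product: \<open>D / c\<close> is the orthogonal projection
  of \<open>0\<close> onto the affine hyperplane of all \<open>\<alpha>\<close> with \<open>E(\<alpha> D S) = 1\<close>.
\<close>

lemma weighted_square_decomposition:
  fixes \<alpha> D S :: "'a \<Rightarrow> real"
  assumes "c \<noteq> 0"
    and a: "integrable M (\<lambda>\<omega>. (\<alpha> \<omega>)\<^sup>2 * S \<omega>)"
    and D: "integrable M (\<lambda>\<omega>. (D \<omega>)\<^sup>2 * S \<omega>)" "(\<integral>\<omega>. (D \<omega>)\<^sup>2 * S \<omega> \<partial>M) = c"
    and aD: "integrable M (\<lambda>\<omega>. \<alpha> \<omega> * D \<omega> * S \<omega>)" "(\<integral>\<omega>. \<alpha> \<omega> * D \<omega> * S \<omega> \<partial>M) = 1"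
  shows "integrable M (\<lambda>\<omega>. (\<alpha> \<omega> - D \<omega> / c)\<^sup>2 * S \<omega>)"
    and "(\<integral>\<omega>. (\<alpha> \<omega>)\<^sup>2 * S \<omega> \<partial>M) = 1 / c + (\<integral>\<omega>. (\<alpha> \<omega> - D \<omega> / c)\<^sup>2 * S \<omega> \<partial>M)"
proof -
  have eq: "(\<alpha> \<omega> - D \<omega> / c)\<^sup>2 * S \<omega>
      = (\<alpha> \<omega>)\<^sup>2 * S \<omega> - (2 / c) * (\<alpha> \<omega> * D \<omega> * S \<omega>) + (1 / c\<^sup>2) * ((D \<omega>)\<^sup>2 * S \<omega>)" for \<omega>
    by (simp add: power2_eq_square algebra_simps)
  show "integrable M (\<lambda>\<omega>. (\<alpha> \<omega> - D \<omega> / c)\<^sup>2 * S \<omega>)"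
    unfolding eq
    by (intro Bochner_Integration.integrable_add Bochner_Integration.integrable_diff
        integrable_mult_right a D aD)
  have "(\<integral>\<omega>. (\<alpha> \<omega> - D \<omega> / c)\<^sup>2 * S \<omega> \<partial>M) = (\<integral>\<omega>. (\<alpha> \<omega>)\<^sup>2 * S \<omega> \<partial>M) - 2 / c * 1 + 1 / c\<^sup>2 * c"
    unfolding eq
    using Bochner_Integration.integral_add[OF Bochner_Integration.integrable_diff
        [OF a integrable_mult_right[OF aD(1), of "2 / c"]] integrable_mult_right[OF D(1), of "1 / c\<^sup>2"]]
      Bochner_Integration.integral_diff[OF a integrable_mult_right[OF aD(1), of "2 / c"]]
    by (simp only: D aD integral_mult_right_zero)
  then show "(\<integral>\<omega>. (\<alpha> \<omega>)\<^sup>2 * S \<omega> \<partial>M) = 1 / c + (\<integral>\<omega>. (\<alpha> \<omega> - D \<omega> / c)\<^sup>2 * S \<omega> \<partial>M)"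
    using \<open>c \<noteq> 0\<close> by (simp add: power2_eq_square)
qed

theorem theorem2:
  fixes M :: "'w measure"
    and Y A :: "'w \<Rightarrow> real"
    and X :: "'w \<Rightarrow> real ^ 'p"
    and AX :: "'w \<Rightarrow> real \<times> (real ^ 'p)"
    and \<mu> \<sigma>2 d :: "real \<times> (real ^ 'p) \<Rightarrow> real"
    and m0 m1 \<pi>' :: "real ^ 'p \<Rightarrow> real"
  assumes "prob_space M"
    and "Y \<in> borel_measurable M" and "A \<in> borel_measurable M" and "X \<in> borel_measurable M"
    and AX: "\<And>\<omega>. AX \<omega> = (A \<omega>, X \<omega>)"
    and mean: "is_cond_mean M AX Y \<mu>" and mean_L2: "\<mu> \<in> L2_fun M AX"
    and var: "is_cond_var M AX Y \<sigma>2" and var_pos: "AE \<omega> in M. \<sigma>2 (AX \<omega>) > 0"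
    and m1: "is_cond_mean M X (\<lambda>\<omega>. A \<omega> / \<sigma>2 (AX \<omega>)) m1"
    and m0: "is_cond_mean M X (\<lambda>\<omega>. 1 / \<sigma>2 (AX \<omega>)) m0"
    and pi: "\<And>x. \<pi>' x = m1 x / m0 x"
    and d: "\<And>a x. d (a, x) = (a - \<pi>' x) / \<sigma>2 (a, x)"
    and d_L2: "d \<in> L2_fun M AX"
    and dA: "(\<integral>\<omega>. d (AX \<omega>) * A \<omega> \<partial>M) \<noteq> 0"
  shows "is_arg_min (efficiency_bound M AX \<sigma>2) (feasible M A X)
           (\<lambda>z. d z / (\<integral>\<omega>. d (AX \<omega>) * A \<omega> \<partial>M)) \<and>
         (\<forall>\<alpha>. is_arg_min (efficiency_bound M AX \<sigma>2) (feasible M A X) \<alpha> \<longrightarrow>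
           (AE \<omega> in M. \<alpha> (AX \<omega>) = d (AX \<omega>) / (\<integral>\<omega>'. d (AX \<omega>') * A \<omega>' \<partial>M))) \<and>
         integrable M (\<lambda>\<omega>. d (AX \<omega>) * Y \<omega>) \<and>
         L2_inner M AX \<mu> (\<lambda>z. d z / (\<integral>\<omega>. d (AX \<omega>) * A \<omega> \<partial>M)) =
           (\<integral>\<omega>. d (AX \<omega>) * Y \<omega> \<partial>M) / (\<integral>\<omega>. d (AX \<omega>) * A \<omega> \<partial>M)"
proof -
  interpret prob_space M by fact
  have AX': "AX = (\<lambda>\<omega>. (A \<omega>, X \<omega>))" using AX by auto
  note [measurable] = \<open>Y \<in> borel_measurable M\<close> \<open>A \<in> borel_measurable M\<close> \<open>X \<in> borel_measurable M\<close>
  have AXM[measurable]: "AX \<in> borel_measurable M" unfolding AX' by measurable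
  interpret FX: sigma_finite_subalgebra M "sigma_gen M X"
    by (rule sigma_finite_subalgebra_sigma_gen) fact
  interpret FAX: sigma_finite_subalgebra M "sigma_gen M AX"
    by (rule sigma_finite_subalgebra_sigma_gen) fact

  have [measurable]: "\<mu> \<in> borel_measurable borel" "\<sigma>2 \<in> borel_measurable borel"
    "m1 \<in> borel_measurable borel" "m0 \<in> borel_measurable borel" "d \<in> borel_measurable borel"
    using mean var m1 m0 d_L2 by (auto simp: is_cond_mean_def is_cond_var_def L2_fun_def)
  have mX: "(\<lambda>\<omega>. m0 (X \<omega>)) \<in> borel_measurable (sigma_gen M X)"
      "(\<lambda>\<omega>. m1 (X \<omega>)) \<in> borel_measurable (sigma_gen M X)"
    by (rule measurable_sigma_gen_comp, fact)+
  have piX: "(\<lambda>\<omega>. \<pi>' (X \<omega>)) \<in> borel_measurable (sigma_gen M X)"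
    unfolding pi by (intro borel_measurable_divide mX)
  have piM[measurable]: "(\<lambda>\<omega>. \<pi>' (X \<omega>)) \<in> borel_measurable M"
    by (rule measurable_from_subalg[OF FX.subalg piX])
  have dF: "(\<lambda>\<omega>. d (AX \<omega>)) \<in> borel_measurable (sigma_gen M AX)"
    by (rule measurable_sigma_gen_comp) fact

  define D where "D \<omega> = d (AX \<omega>)" for \<omega>
  define S where "S \<omega> = \<sigma>2 (AX \<omega>)" for \<omega>
  define c where "c = (\<integral>\<omega>. D \<omega> * A \<omega> \<partial>M)"
  have c0: "c \<noteq> 0" using dA by (simp add: c_def D_def)
  have DM[measurable]: "D \<in> borel_measurable M" unfolding D_def by measurable
  have SM[measurable]: "S \<in> borel_measurable M" unfolding S_def by measurable
  have S_pos: "AE \<omega> in M. 0 < S \<omega>" using var_pos by (simp add: S_def)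
  have D_eq: "D \<omega> = (A \<omega> - \<pi>' (X \<omega>)) * (1 / S \<omega>)" for \<omega>
    by (simp add: D_def AX d S_def)
  have DS: "AE \<omega> in M. D \<omega> * S \<omega> = A \<omega> - \<pi>' (X \<omega>)"
    using S_pos by eventually_elim (simp add: D_eq)
  have D2: "integrable M (\<lambda>\<omega>. (D \<omega>)\<^sup>2)" using d_L2 by (simp add: L2_fun_def D_def)
  have D_int: "integrable M D" by (rule square_integrable_imp_integrable[OF DM D2])
  \<comment> \<open>Bochner integrals of non-integrable functions are \<open>0\<close>, hence \<open>c \<noteq> 0\<close> carries integrability.\<close>
  have DA_int: "integrable M (\<lambda>\<omega>. D \<omega> * A \<omega>)"
    using c0 unfolding c_def by (metis not_integrable_integral_eq)

  have D_centered: "AE \<omega> in M. real_cond_exp M (sigma_gen M X) D \<omega> = 0"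
  proof -
    have "AE \<omega> in M. real_cond_exp M (sigma_gen M X)
        (\<lambda>\<omega>. (A \<omega> - m1 (X \<omega>) / m0 (X \<omega>)) * (1 / S \<omega>)) \<omega> = 0"
    proof (rule FX.real_cond_exp_weighted_centering[OF mX])
      show "integrable M (\<lambda>\<omega>. (A \<omega> - m1 (X \<omega>) / m0 (X \<omega>)) * (1 / S \<omega>))"
        using D_int by (simp add: D_eq[abs_def] pi)
      show "AE \<omega> in M. 0 < 1 / S \<omega>" using S_pos by eventually_elim simp
    qed (use m0 m1 in \<open>auto simp: is_cond_mean_def S_def\<close>)
    then show ?thesis by (simp add: D_eq[abs_def] pi)
  qed

  have D2S_eq: "AE \<omega> in M. D \<omega> * (A \<omega> - \<pi>' (X \<omega>)) = (D \<omega>)\<^sup>2 * S \<omega>"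
    using DS by eventually_elim (simp add: power2_eq_square flip: mult.assoc)
  have nonneg: "AE \<omega> in M. 0 \<le> D \<omega> * (A \<omega> - \<pi>' (X \<omega>))"
    using D2S_eq S_pos by eventually_elim simp
  note D_A = FX.integral_mult_diff_conditionally_centered
    [OF piX \<open>A \<in> borel_measurable M\<close> D_int D_centered DA_int nonneg]
  have D2S_int: "integrable M (\<lambda>\<omega>. (D \<omega>)\<^sup>2 * S \<omega>)"
    by (rule integrable_cong_AE_imp[OF D_A(1)]) (use D2S_eq in auto)
  have D2S: "(\<integral>\<omega>. (D \<omega>)\<^sup>2 * S \<omega> \<partial>M) = c"
    using D_A(2) integral_cong_AE[OF _ _ D2S_eq] by (simp add: c_def)

  have bound_fin: "efficiency_bound M AX \<sigma>2 \<alpha> = ennreal (\<integral>\<omega>. (\<alpha> (AX \<omega>))\<^sup>2 * S \<omega> \<partial>M)"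
    if "integrable M (\<lambda>\<omega>. (\<alpha> (AX \<omega>))\<^sup>2 * S \<omega>)" for \<alpha>
    unfolding efficiency_bound_def S_def[symmetric]
    by (rule nn_integral_eq_integral[OF that]) (use S_pos in eventually_elim, simp)

  define \<alpha>0 where "\<alpha>0 z = d z / c" for z
  have \<alpha>0_AX: "\<alpha>0 (AX \<omega>) = D \<omega> / c" for \<omega> by (simp add: \<alpha>0_def D_def)
  have \<alpha>0_feasible: "feasible M A X \<alpha>0"
    unfolding feasible_def AX[symmetric] AX'[symmetric] \<alpha>0_AX
  proof (intro conjI)
    show "\<alpha>0 \<in> L2_fun M AX"
      using D2 by (auto simp: L2_fun_def \<alpha>0_AX power_divide) (simp add: \<alpha>0_def[abs_def])
    show "(\<integral>\<omega>. D \<omega> / c * A \<omega> \<partial>M) = 1" using c0 by (simp add: c_def)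
    show "AE \<omega> in M. real_cond_exp M (sigma_gen M X) (\<lambda>\<omega>'. D \<omega>' / c) \<omega> = 0"
      using FX.real_cond_exp_cdiv[OF D_int, of c] D_centered by eventually_elim simp
  qed
  have \<alpha>0_bound: "efficiency_bound M AX \<sigma>2 \<alpha>0 = ennreal (1 / c)"
  proof -
    have eq: "(D \<omega> / c)\<^sup>2 * S \<omega> = (D \<omega>)\<^sup>2 * S \<omega> / c\<^sup>2" for \<omega> by (simp add: power_divide)
    show ?thesis
      using bound_fin[of \<alpha>0] D2S_int c0 D2S by (simp add: \<alpha>0_AX eq power2_eq_square)
  qed

  \<comment> \<open>A finite bound makes \<open>\<alpha> D S\<close> integrable, and the first constraint contains the integrability
    of \<open>\<alpha> A\<close>; their difference \<open>\<pi>'(X) \<alpha>\<close> is then integrable as well, so that the second constraint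
    makes its mean vanish.\<close>
  have decomp: "integrable M (\<lambda>\<omega>. (\<alpha> (AX \<omega>) - D \<omega> / c)\<^sup>2 * S \<omega>)
      \<and> efficiency_bound M AX \<sigma>2 \<alpha>
        = ennreal (1 / c + (\<integral>\<omega>. (\<alpha> (AX \<omega>) - D \<omega> / c)\<^sup>2 * S \<omega> \<partial>M))"
    if feas: "feasible M A X \<alpha>" and fin: "efficiency_bound M AX \<sigma>2 \<alpha> < \<infinity>" for \<alpha>
  proof -
    define a where "a \<omega> = \<alpha> (AX \<omega>)" for \<omega>
    have [measurable]: "\<alpha> \<in> borel_measurable borel" and a2: "integrable M (\<lambda>\<omega>. (a \<omega>)\<^sup>2)"
      and aA: "(\<integral>\<omega>. a \<omega> * A \<omega> \<partial>M) = 1"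
      and a_centered: "AE \<omega> in M. real_cond_exp M (sigma_gen M X) a \<omega> = 0"
      using feas by (auto simp: feasible_def L2_fun_def a_def[abs_def] AX)
    have aM[measurable]: "a \<in> borel_measurable M" unfolding a_def by measurable
    have aA_int: "integrable M (\<lambda>\<omega>. a \<omega> * A \<omega>)"
      using aA by (metis not_integrable_integral_eq zero_neq_one)
    have a2S: "integrable M (\<lambda>\<omega>. (a \<omega>)\<^sup>2 * S \<omega>)"
    proof (rule integrableI_nonneg)
      show "AE \<omega> in M. 0 \<le> (a \<omega>)\<^sup>2 * S \<omega>" using S_pos by eventually_elim simp
      show "(\<integral>\<^sup>+\<omega>. ennreal ((a \<omega>)\<^sup>2 * S \<omega>) \<partial>M) < \<infinity>"
        using fin by (simp add: efficiency_bound_def a_def S_def)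
    qed measurable
    have S_nn: "AE \<omega> in M. 0 \<le> S \<omega>" using S_pos by eventually_elim simp
    have aDS_int: "integrable M (\<lambda>\<omega>. a \<omega> * D \<omega> * S \<omega>)"
      by (rule integrable_mult_of_weighted_square_integrable[OF aM DM SM S_nn a2S D2S_int])
    have aDS_eq: "AE \<omega> in M. a \<omega> * D \<omega> * S \<omega> = a \<omega> * A \<omega> - \<pi>' (X \<omega>) * a \<omega>"
      using DS by eventually_elim algebra
    have "integrable M (\<lambda>\<omega>. a \<omega> * A \<omega> - a \<omega> * D \<omega> * S \<omega>)"
      using aA_int aDS_int by simp
    then have pa_int: "integrable M (\<lambda>\<omega>. \<pi>' (X \<omega>) * a \<omega>)"
      by (rule integrable_cong_AE_imp) (use aDS_eq in auto)
    have "(\<integral>\<omega>. a \<omega> * D \<omega> * S \<omega> \<partial>M) = (\<integral>\<omega>. a \<omega> * A \<omega> - \<pi>' (X \<omega>) * a \<omega> \<partial>M)"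
      by (rule integral_cong_AE[OF _ _ aDS_eq]) measurable
    also have "\<dots> = 1"
      using FX.integral_mult_conditionally_centered[OF piX aM pa_int a_centered] aA aA_int pa_int
      by simp
    finally have aDS: "(\<integral>\<omega>. a \<omega> * D \<omega> * S \<omega> \<partial>M) = 1" .
    show ?thesis
      using weighted_square_decomposition[OF c0 a2S D2S_int D2S aDS_int aDS]
        bound_fin[of \<alpha>, folded a_def, OF a2S] unfolding a_def by simp
  qed

  have gap_nonneg: "0 \<le> (\<integral>\<omega>. (\<alpha> (AX \<omega>) - D \<omega> / c)\<^sup>2 * S \<omega> \<partial>M)" for \<alpha>
    by (rule integral_nonneg_AE) (use S_pos in eventually_elim, simp)
  have c_pos: "0 < c"
  proof -
    have "0 \<le> c"
      unfolding D2S[symmetric] by (rule integral_nonneg_AE) (use S_pos in eventually_elim, simp)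
    then show ?thesis using c0 by simp
  qed

  have opt: "is_arg_min (efficiency_bound M AX \<sigma>2) (feasible M A X) \<alpha>0"
    unfolding is_arg_min_def
  proof (intro conjI notI)
    show "feasible M A X \<alpha>0" by (rule \<alpha>0_feasible)
    assume "\<exists>\<alpha>. feasible M A X \<alpha> \<and> efficiency_bound M AX \<sigma>2 \<alpha> < efficiency_bound M AX \<sigma>2 \<alpha>0"
    then obtain \<alpha> where feas: "feasible M A X \<alpha>"
      and less: "efficiency_bound M AX \<sigma>2 \<alpha> < ennreal (1 / c)" by (auto simp: \<alpha>0_bound)
    have "efficiency_bound M AX \<sigma>2 \<alpha> < \<infinity>" using less less_trans by fastforce
    from decomp[OF feas this] less have
      "ennreal (1 / c + (\<integral>\<omega>. (\<alpha> (AX \<omega>) - D \<omega> / c)\<^sup>2 * S \<omega> \<partial>M)) < ennreal (1 / c)" by simp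
    moreover have "ennreal (1 / c) \<le> ennreal (1 / c + (\<integral>\<omega>. (\<alpha> (AX \<omega>) - D \<omega> / c)\<^sup>2 * S \<omega> \<partial>M))"
      by (rule ennreal_leI) (use gap_nonneg[of \<alpha>] in simp)
    ultimately show False by (simp add: leD)
  qed

  have uniq: "AE \<omega> in M. \<alpha> (AX \<omega>) = D \<omega> / c"
    if "is_arg_min (efficiency_bound M AX \<sigma>2) (feasible M A X) \<alpha>" for \<alpha>
  proof -
    let ?gap = "\<lambda>\<omega>. (\<alpha> (AX \<omega>) - D \<omega> / c)\<^sup>2 * S \<omega>"
    have feas: "feasible M A X \<alpha>" and le: "efficiency_bound M AX \<sigma>2 \<alpha> \<le> ennreal (1 / c)"
      using that \<alpha>0_feasible \<alpha>0_bound by (auto simp: is_arg_min_def not_less)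
    have "efficiency_bound M AX \<sigma>2 \<alpha> < \<infinity>" using le le_less_trans by fastforce
    note dec = decomp[OF feas this]
    from dec le have "ennreal (1 / c + integral\<^sup>L M ?gap) \<le> ennreal (1 / c)" by simp
    then have "integral\<^sup>L M ?gap = 0"
      using c_pos gap_nonneg[of \<alpha>] by simp
    moreover have "AE \<omega> in M. 0 \<le> ?gap \<omega>" using S_pos by eventually_elim simp
    ultimately have "AE \<omega> in M. ?gap \<omega> = 0"
      using dec integral_nonneg_eq_0_iff_AE by blast
    then show ?thesis using S_pos by eventually_elim simp
  qed

  have mean_eq: "AE \<omega> in M. \<mu> (AX \<omega>) = real_cond_exp M (sigma_gen M AX) Y \<omega>"
    using mean by (simp add: is_cond_mean_def)
  have D\<mu>: "integrable M (\<lambda>\<omega>. D \<omega> * \<mu> (AX \<omega>))"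
    using D2 mean_L2 by (intro integrable_mult_of_square_integrable) (auto simp: L2_fun_def)
  have DY: "integrable M (\<lambda>\<omega>. D \<omega> * Y \<omega>)"
  proof (rule FAX.integrable_mult_of_cond_var[OF finite_measure_axioms])
    show "D \<in> borel_measurable (sigma_gen M AX)" using dF by (simp add: D_def[abs_def])
    show "AE \<omega> in M. ennreal (S \<omega>) = nn_cond_exp M (sigma_gen M AX)
        (\<lambda>\<omega>. ennreal ((Y \<omega> - real_cond_exp M (sigma_gen M AX) Y \<omega>)\<^sup>2)) \<omega>"
      using var by (auto simp: is_cond_var_def S_def)
    show "integrable M (\<lambda>\<omega>. D \<omega> * real_cond_exp M (sigma_gen M AX) Y \<omega>)"
      by (rule integrable_cong_AE_imp[OF D\<mu>]) (use mean_eq in auto)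
  qed (use D2S_int in auto)
  have "(\<integral>\<omega>. D \<omega> * \<mu> (AX \<omega>) \<partial>M) = (\<integral>\<omega>. D \<omega> * real_cond_exp M (sigma_gen M AX) Y \<omega> \<partial>M)"
    by (rule integral_cong_AE) (use mean_eq in auto)
  also have "\<dots> = (\<integral>\<omega>. D \<omega> * Y \<omega> \<partial>M)"
    by (rule FAX.real_cond_exp_intg(2)[OF DY]) (use dF in \<open>auto simp: D_def[abs_def]\<close>)
  finally have estimand: "L2_inner M AX \<mu> \<alpha>0 = (\<integral>\<omega>. D \<omega> * Y \<omega> \<partial>M) / c"
    by (simp add: L2_inner_def \<alpha>0_AX mult.commute)

  note unfold = \<alpha>0_def[abs_def] c_def D_def
  show ?thesis
    by (intro conjI allI impI)
      (rule opt[unfolded unfold] uniq[unfolded unfold] DY[unfolded unfold]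
        estimand[unfolded unfold], assumption?)+
qed

end
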